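(* Let $N\ge 1$, let $\mathbf{F}:\mathbb{R}^N\to\mathbb{R}^N$, $\mathbf{F}=(f_1,\dots,f_N)$, be differentiable, and consider the autonomous system $\ddot{\mathbf{X}}=\mathbf{F}(\mathbf{X})$ of an $N$-degrees-of-freedom mechanical system with equilibrium $\mathbf{X}=0$. Let $G_0$ be a discrete symmetry group (the parent group) acting linearly on $\mathbb{R}^N$ through its mechanical representation $g\mapsto \mathrm{M}(g)\in GL_N(\mathbb{R})$, and suppose the system is invariant under $G_0$, i.e. $\mathbf{F}(\mathrm{M}(g)\mathbf{X})=\mathrm{M}(g)\mathbf{F}(\mathbf{X})$ for all $g\in G_0$ and $\mathbf{X}\in\mathbb{R}^N$. Let $G\subseteq G_0$ be a subgroup and let $\mathbf{C}(t)$ be a dynamical regime belonging to the bush $\mathrm{B}[G]$. Let $\mathrm{J}[\mathbf{C}(t)]=\left(\frac{\partial f_i}{\partial x_j}\big|_{\mathbf{X}=\mathbf{C}(t)}\right)_{i,j=1}^N$ be the matrix of the system $\ddot{\boldsymbol{\delta}}=\mathrm{J}[\mathbf{C}(t)]\,\boldsymbol{\delta}$ obtained by linearizing $\ddot{\mathbf{X}}=\mathbf{F}(\mathbf{X})$ near $\mathbf{C}(t)$. Then for every $g\in G$ and every $t$, $$\mathrm{M}(g)\cdot\mathrm{J}[\mathbf{C}(t)]=\mathrm{J}[\mathbf{C}(t)]\cdot\mathrm{M}(g).$$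
   Context: The configuration vector $\mathbf{X}(t)=(x_1(t),\dots,x_N(t))$ describes the displacements of the system from its equilibrium state $\mathbf{X}=0$. Each $g\in G_0$ acts on configuration vectors by a linear operator $\hat g$; the mechanical representation is the matrix representation of the group in the standard basis $\mathbf{e}_1,\dots,\mathbf{e}_N$ of $\mathbb{R}^N$, given by $\hat g\,\mathbf{e}_j=\sum_i \mathrm{M}_{ij}(g)\mathbf{e}_i$, so that $\hat g\mathbf{X}=\mathrm{M}(g)\mathbf{X}$. For a subgroup $G\subseteq G_0$, the bush $\mathrm{B}[G]$ is the invariant manifold of all $\mathbf{X}$ with $\hat g\mathbf{X}=\mathbf{X}$ for all $g\in G$. A dynamical regime belonging to $\mathrm{B}[G]$ is a solution $\mathbf{C}(t)$ of $\ddot{\mathbf{X}}=\mathbf{F}(\mathbf{X})$ with $\mathrm{M}(g)\mathbf{C}(t)=\mathbf{C}(t)$ for all $g\in G$ and all $t$. *)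

theory Defs
  imports "HOL-Analysis.Analysis" "HOL-Algebra.Group_Action"
begin

text \<open>
  The parent group is an abstract group without a topology, that is, a group with the discrete
  topology; it acts on configuration vectors by linear bijections.
\<close>

definition linear_group_action ::
    "('g, 'b) monoid_scheme \<Rightarrow> ('g \<Rightarrow> real^'n \<Rightarrow> real^'n) \<Rightarrow> bool" where
  "linear_group_action G0 act \<longleftrightarrow>
     group_action G0 UNIV act \<and> (\<forall>g\<in>carrier G0. linear (act g))"

text \<open>
  The library function \<^const>\<open>matrix\<close> takes coordinates in the standard basis: column \<open>j\<close> of
  \<open>mech_rep act g\<close> is the image under \<open>act g\<close> of the basis vector \<open>axis j 1\<close>.
\<close>

definition mech_rep :: "('g \<Rightarrow> real^'n \<Rightarrow> real^'n) \<Rightarrow> 'g \<Rightarrow> real^'n^'n" where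
  "mech_rep act g = matrix (act g)"

definition bush :: "('g \<Rightarrow> real^'n \<Rightarrow> real^'n) \<Rightarrow> 'g set \<Rightarrow> (real^'n) set" where
  "bush act G = {X. \<forall>g\<in>G. act g X = X}"

text \<open>
  Time ranges over an arbitrary nondegenerate interval \<open>T\<close> of existence, with one-sided
  derivatives at any endpoint that belongs to \<open>T\<close>; global solutions are the case
  \<open>T = UNIV\<close>.
\<close>

definition newton_solution ::
    "(real^'n \<Rightarrow> real^'n) \<Rightarrow> real set \<Rightarrow> (real \<Rightarrow> real^'n) \<Rightarrow> bool" where
  "newton_solution F T C \<longleftrightarrow>
     is_interval T \<and> interior T \<noteq> {} \<and>
     (\<exists>V. \<forall>t\<in>T. (C has_vector_derivative V t) (at t within T) \<and>
                  (V has_vector_derivative F (C t)) (at t within T))"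

definition bush_regime ::
    "('g \<Rightarrow> real^'n \<Rightarrow> real^'n) \<Rightarrow> 'g set \<Rightarrow> (real^'n \<Rightarrow> real^'n) \<Rightarrow> real set \<Rightarrow>
     (real \<Rightarrow> real^'n) \<Rightarrow> bool" where
  "bush_regime act G F T C \<longleftrightarrow>
     newton_solution F T C \<and> (\<forall>t\<in>T. C t \<in> bush act G)"

definition partial_deriv :: "'n \<Rightarrow> (real^'n \<Rightarrow> real) \<Rightarrow> real^'n \<Rightarrow> real" where
  "partial_deriv j f X = deriv (\<lambda>s. f (X + s *\<^sub>R axis j 1)) 0"

definition jacobian_matrix :: "(real^'n \<Rightarrow> real^'n) \<Rightarrow> real^'n \<Rightarrow> real^'n^'n" where
  "jacobian_matrix F X = (\<chi> i j. partial_deriv j (\<lambda>Y. F Y $ i) X)"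

end

theory Submission
  imports Defs
begin

text \<open>
  Differentiating \<open>F (M X) = M F X\<close> by the chain rule gives \<open>J[M X] M = M J[X]\<close>, and every
  point \<open>X\<close> of the bush is fixed by the matrices \<open>M\<close> of the elements of \<open>G\<close>.
\<close>

text \<open>Along the line \<open>X + s *\<^sub>R axis j 1\<close> the chain rule reduces the total
  derivative to a function of \<open>s\<close> alone. This connects the entrywise
  \<open>deriv\<close> in \<open>jacobian_matrix\<close> with the Frechet derivative, for which the
  chain rule is available.\<close>

lemma jacobian_matrix_eq_matrix:
  fixes F :: "real^'n \<Rightarrow> real^'n"
  assumes "(F has_derivative F') (at X)"
  shows "jacobian_matrix F X = matrix F'"
proof -
  have "partial_deriv j (\<lambda>Y. F Y $ i) X = F' (axis j 1) $ i" for i j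
  proof -
    have line: "((\<lambda>s. X + s *\<^sub>R axis j 1) has_derivative (\<lambda>s. s *\<^sub>R axis j 1)) (at (0::real))"
      by (auto intro!: derivative_eq_intros)
    \<comment> \<open>The base point is written as the value of the line at \<open>s = 0\<close>,
      the form in which the chain rule asks for it.\<close>
    have F: "(F has_derivative F') (at (X + (0::real) *\<^sub>R axis j 1))"
      using assms by simp
    have "((\<lambda>s. F (X + s *\<^sub>R axis j 1)) has_derivative (\<lambda>s. F' (s *\<^sub>R axis j 1))) (at (0::real))"
      using has_derivative_compose[OF line F] by simp
    then have "((\<lambda>s. F (X + s *\<^sub>R axis j 1) $ i) has_derivative (\<lambda>s. F' (s *\<^sub>R axis j 1) $ i))
        (at (0::real))"
      by (rule bounded_linear.has_derivative[OF bounded_linear_vec_nth])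
    \<comment> \<open>Linearity of \<open>F'\<close> pulls out \<open>s\<close>, so the derivative
      becomes multiplication by a number, as \<open>has_field_derivative\<close> requires.\<close>
    moreover have "(\<lambda>s. F' (s *\<^sub>R axis j 1) $ i) = (*) (F' (axis j 1) $ i)"
      using linear_scale[OF has_derivative_linear[OF assms]] by (auto simp: mult.commute)
    ultimately have "((\<lambda>s. F (X + s *\<^sub>R axis j 1) $ i) has_field_derivative F' (axis j 1) $ i)
        (at (0::real))"
      by (simp add: has_field_derivative_def)
    then show ?thesis
      unfolding partial_deriv_def by (rule DERIV_imp_deriv)
  qed
  then show ?thesis
    by (simp add: jacobian_matrix_def matrix_def)
qed

lemma jacobian_matrix_equivariant:
  fixes F :: "real^'n \<Rightarrow> real^'n" and M :: "real^'n^'n"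
  assumes equivariant: "\<And>Y. F (M *v Y) = M *v F Y"
    and "F differentiable (at X)" "F differentiable (at (M *v X))"
  shows "M ** jacobian_matrix F X = jacobian_matrix F (M *v X) ** M"
proof -
  obtain F' where F': "(F has_derivative F') (at X)"
    using assms(2) by (auto simp: differentiable_def)
  obtain F'' where F'': "(F has_derivative F'') (at (M *v X))"
    using assms(3) by (auto simp: differentiable_def)
  have M: "((*v) M has_derivative (*v) M) (at Y)" for Y
    by (simp add: bounded_linear_imp_has_derivative matrix_vector_mul_bounded_linear)
  have "((\<lambda>Y. M *v F Y) has_derivative (\<lambda>h. M *v F' h)) (at X)"
    using has_derivative_compose[OF F' M] .
  moreover have "((\<lambda>Y. M *v F Y) has_derivative (\<lambda>h. F'' (M *v h))) (at X)"
    using has_derivative_compose[OF M F''] by (simp add: equivariant)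
  \<comment> \<open>By equivariance the same map has been differentiated at \<open>X\<close> in two
    ways, so uniqueness of the derivative equates the results.\<close>
  ultimately have "(*v) M \<circ> F' = F'' \<circ> (*v) M"
    unfolding comp_def by (rule has_derivative_unique)
  then have "matrix ((*v) M) ** matrix F' = matrix F'' ** matrix ((*v) M)"
    using F' F'' by (metis has_derivative_linear matrix_compose matrix_vector_mul_linear)
  then show ?thesis
    by (simp add: jacobian_matrix_eq_matrix[OF F'] jacobian_matrix_eq_matrix[OF F''])
qed

theorem theorem1:
  fixes G0 :: "('g, 'b) monoid_scheme"
    and act :: "'g \<Rightarrow> real^'n \<Rightarrow> real^'n"
    and F :: "real^'n \<Rightarrow> real^'n"
    and G :: "'g set"
    and T :: "real set"
    and C :: "real \<Rightarrow> real^'n"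
  assumes "linear_group_action G0 act"
    and "\<forall>X. F differentiable (at X)"
    and "F 0 = 0"
    and "\<forall>g\<in>carrier G0. \<forall>X. F (mech_rep act g *v X) = mech_rep act g *v F X"
    and "subgroup G G0"
    and "bush_regime act G F T C"
  shows "\<forall>g\<in>G. \<forall>t\<in>T.
           mech_rep act g ** jacobian_matrix F (C t) = jacobian_matrix F (C t) ** mech_rep act g"
proof (intro ballI)
  fix g t
  assume "g \<in> G" "t \<in> T"
  have g: "g \<in> carrier G0"
    using \<open>g \<in> G\<close> subgroup.subset[OF assms(5)] by blast
  have "linear (act g)"
    using assms(1) g by (simp add: linear_group_action_def)
  \<comment> \<open>The bush is defined by the operators \<open>act g\<close>, the symmetry of
    \<open>F\<close> by their matrices; linearity makes the two agree.\<close>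
  then have "mech_rep act g *v C t = act g (C t)"
    by (simp add: mech_rep_def matrix_works)
  also have "\<dots> = C t"
    using assms(6) \<open>g \<in> G\<close> \<open>t \<in> T\<close> by (simp add: bush_regime_def bush_def)
  \<comment> \<open>Since \<open>C t\<close> is fixed, the Jacobian at the image point is again the
    one at \<open>C t\<close>, and the intertwining relation becomes commutation.\<close>
  finally show "mech_rep act g ** jacobian_matrix F (C t) =
      jacobian_matrix F (C t) ** mech_rep act g"
    using jacobian_matrix_equivariant[of F "mech_rep act g" "C t"] assms(2,4) g by simp
qed

end
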